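(* Let $\mathcal G$ be a connected groupoid, $x\in\mathcal G_0$, $\tau(x)=\{\tau_y\}_{y\in\mathcal G_0}$ a transversal for $x$, $A$ a ring and $(I,\gamma_{\tau(x)},\gamma_{(x)})$ an object of $\mathcal D_{\tau(x)}(A)$. For $g\in\mathcal G$ define the partial bijection $\beta_g$ of $A$ by $$\beta_g=\begin{cases}\mathrm{id}_{I_y}, & g=y\in\mathcal G_0,\\ \gamma_{\tau_{t(g)}}\circ\gamma_{g_x}\circ\gamma_{\tau_{s(g)}}^{-1}, & g\notin\mathcal G_0,\end{cases}$$ and let $B_g$ be the range of $\beta_g$, that is, $B_y=I_y$ for $y\in\mathcal G_0$ and $B_g=\gamma_{\tau_{t(g)}}\big(I_{\tau_{t(g)}^{-1}}\cap\gamma_{g_x}(I_{\tau_{s(g)}^{-1}}\cap I_{g_x^{-1}})\big)$ for $g\notin\mathcal G_0$. Then $\beta=(B_g,\beta_g)_{g\in\mathcal G}$ is a partial action of $\mathcal G$ on $A$.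
   Context: Conventions. Rings are associative, not necessarily unital; ideals are two-sided. A groupoid $\mathcal G$ is a small category in which every morphism is invertible; it is identified with its set of morphisms, and its set of objects $\mathcal G_0$ is identified with the set of identity morphisms. For $g\in\mathcal G$, $s(g)=g^{-1}g$ and $t(g)=gg^{-1}$ are its source and target; $gh$ is defined iff $s(g)=t(h)$. Put $\mathcal G(y,z)=\{g: s(g)=y,\ t(g)=z\}$ and $\mathcal G(x)=\mathcal G(x,x)$ (a group). $\mathcal G$ is connected if $\mathcal G(y,z)\neq\emptyset$ for all $y,z\in\mathcal G_0$. A transversal for $x\in\mathcal G_0$ is a family $\tau(x)=\{\tau_y: y\in\mathcal G_0\}$ with $\tau_y\in\mathcal G(x,y)$ for each $y$ and $\tau_x=x$. Put $g_x=\tau_{t(g)}^{-1}g\tau_{s(g)}\in\mathcal G(x)$ for $g\in\mathcal G$. For partial bijections $u,v$ of a set, $u\circ v$ has domain $v^{-1}(\mathrm{dom}(u)\cap\mathrm{ran}(v))$ and range $u(\mathrm{dom}(u)\cap\mathrm{ran}(v))$; $u\le v$ means that $\mathrm{dom}(u)\subseteq\mathrm{dom}(v)$ and $v$ agrees with $u$ on $\mathrm{dom}(u)$. A partial action of a groupoid $\mathcal G$ on a ring $A$ is a family $\alpha=(A_g,\alpha_g)_{g\in\mathcal G}$ where, for each $g\in\mathcal G$, $A_{t(g)}$ is an ideal of $A$, $A_g$ is an ideal of $A_{t(g)}$, $\alpha_g:A_{g^{-1}}\to A_g$ is a ring isomorphism, $\alpha_y=\mathrm{id}_{A_y}$ for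 all $y\in\mathcal G_0$, and $\alpha_g\alpha_h\le\alpha_{gh}$ whenever $s(g)=t(h)$. A partial action of a group $H$ on a ring $R$ is the one-object case with the ideal attached to the identity of $H$ equal to $R$. An object of $\mathcal D_{\tau(x)}(A)$ is a datum $(I,\gamma_{\tau(x)},\gamma_{(x)})$ consisting of: (a) a family $I=\{I_y\}_{y\in\mathcal G_0}$ of ideals of $A$; (b) a family of ring isomorphisms $\gamma_{\tau(x)}=\{\gamma_{\tau_y}:I_{\tau_y^{-1}}\to I_{\tau_y}\}_{y\in\mathcal G_0}$; (c) a partial action $\gamma_{(x)}=(I_h,\gamma_h)_{h\in\mathcal G(x)}$ of the group $\mathcal G(x)$ on $I_x$; such that (d) $\gamma_x=\gamma_{\tau_x}$ is the identity map of $I_x=I_{\tau_x}$; (e) $I_{\tau_y}$ is an ideal of $I_y$ and $I_{\tau_y^{-1}}$ is an ideal of $I_x$, for all $y\in\mathcal G_0$; (f) $\gamma_{\tau_{t(g)}}\big(I_{\tau_{t(g)}^{-1}}\cap\gamma_{g_x}(I_{\tau_{s(g)}^{-1}}\cap I_{g_x^{-1}})\big)$ is an ideal of $I_{t(g)}$, for all $g\in\mathcal G$. *)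

theory Defs
  imports Main
begin

section \<open>Groupoids\<close>

text \<open>
  Small categories in arrows-only form: an object is identified with its identity morphism, so
  \<open>src\<close> and \<open>tgt\<close> return identity morphisms. The value \<open>cmp G g h\<close> is meaningful only for
  \<open>g\<close>, \<open>h\<close> in \<open>arr G\<close> with \<open>src G g = tgt G h\<close> (so \<open>h\<close> is applied first).
\<close>

record 'g arrows =
  arr :: "'g set"
  src :: "'g \<Rightarrow> 'g"
  tgt :: "'g \<Rightarrow> 'g"
  cmp :: "'g \<Rightarrow> 'g \<Rightarrow> 'g"

definition objs :: "'g arrows \<Rightarrow> 'g set" where
  "objs G = {e \<in> arr G. src G e = e \<and> tgt G e = e}"

definition small_category :: "'g arrows \<Rightarrow> bool" where
  "small_category G \<longleftrightarrow>
     (\<forall>g \<in> arr G. src G g \<in> objs G \<and> tgt G g \<in> objs G) \<and>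
     (\<forall>g \<in> arr G. cmp G g (src G g) = g \<and> cmp G (tgt G g) g = g) \<and>
     (\<forall>g \<in> arr G. \<forall>h \<in> arr G. src G g = tgt G h \<longrightarrow>
        cmp G g h \<in> arr G \<and> src G (cmp G g h) = src G h \<and> tgt G (cmp G g h) = tgt G g) \<and>
     (\<forall>g \<in> arr G. \<forall>h \<in> arr G. \<forall>k \<in> arr G. src G g = tgt G h \<longrightarrow> src G h = tgt G k \<longrightarrow>
        cmp G (cmp G g h) k = cmp G g (cmp G h k))"

definition inverse_arrow :: "'g arrows \<Rightarrow> 'g \<Rightarrow> 'g \<Rightarrow> bool" where
  "inverse_arrow G g h \<longleftrightarrow> h \<in> arr G \<and> src G h = tgt G g \<and> tgt G h = src G g \<and>
     cmp G h g = src G g \<and> cmp G g h = tgt G g"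

definition groupoid :: "'g arrows \<Rightarrow> bool" where
  "groupoid G \<longleftrightarrow> small_category G \<and> (\<forall>g \<in> arr G. \<exists>h. inverse_arrow G g h)"

definition ginv :: "'g arrows \<Rightarrow> 'g \<Rightarrow> 'g" where
  "ginv G g = (THE h. inverse_arrow G g h)"

definition homset :: "'g arrows \<Rightarrow> 'g \<Rightarrow> 'g \<Rightarrow> 'g set" where
  "homset G y z = {g \<in> arr G. src G g = y \<and> tgt G g = z}"

definition connected_groupoid :: "'g arrows \<Rightarrow> bool" where
  "connected_groupoid G \<longleftrightarrow> groupoid G \<and> (\<forall>y \<in> objs G. \<forall>z \<in> objs G. homset G y z \<noteq> {})"

text \<open>The group of endomorphisms of \<open>x\<close>, as a groupoid with the single object \<open>x\<close>.\<close>

definition vertex_group :: "'g arrows \<Rightarrow> 'g \<Rightarrow> 'g arrows" where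
  "vertex_group G x = G\<lparr>arr := homset G x x\<rparr>"

definition transversal :: "'g arrows \<Rightarrow> 'g \<Rightarrow> ('g \<Rightarrow> 'g) \<Rightarrow> bool" where
  "transversal G x \<tau> \<longleftrightarrow> (\<forall>y \<in> objs G. \<tau> y \<in> homset G x y) \<and> \<tau> x = x"

text \<open>The loop $g_x = \tau_{t(g)}^{-1}\, g\, \tau_{s(g)}$ at the base point of the transversal.\<close>

definition loop_of :: "'g arrows \<Rightarrow> ('g \<Rightarrow> 'g) \<Rightarrow> 'g \<Rightarrow> 'g" where
  "loop_of G \<tau> g = cmp G (ginv G (\<tau> (tgt G g))) (cmp G g (\<tau> (src G g)))"


section \<open>Partial bijections\<close>

text \<open>
  Partial maps of a set are maps \<open>'a \<rightharpoonup> 'a\<close>, with the library operations \<open>dom\<close>, \<open>ran\<close>,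
  \<open>\<circ>\<^sub>m\<close> for composition and \<open>\<subseteq>\<^sub>m\<close> for the extension order.
\<close>

definition pbij :: "('a \<rightharpoonup> 'a) \<Rightarrow> bool" where
  "pbij u \<longleftrightarrow> inj_on u (dom u)"

definition pid :: "'a set \<Rightarrow> ('a \<rightharpoonup> 'a)" where
  "pid X = Some |` X"

definition pinv :: "('a \<rightharpoonup> 'a) \<Rightarrow> ('a \<rightharpoonup> 'a)" where
  "pinv u = (\<lambda>b. if b \<in> ran u then Some (THE a. u a = Some b) else None)"

text \<open>The image of \<open>X\<close>; points of \<open>X\<close> outside the domain of \<open>u\<close> contribute nothing.\<close>

definition pimage :: "('a \<rightharpoonup> 'a) \<Rightarrow> 'a set \<Rightarrow> 'a set" where
  "pimage u X = ran (u |` X)"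


section \<open>Rings, ideals and isomorphisms\<close>

text \<open>
  The class \<open>ring\<close> consists of associative rings without a unit requirement. Ideals of such a ring
  are themselves regarded as rings, so ideals and isomorphisms are defined relative to
  (non-unital) subrings.
\<close>

definition nu_subring :: "'a::ring set \<Rightarrow> bool" where
  "nu_subring R \<longleftrightarrow> 0 \<in> R \<and> (\<forall>a \<in> R. - a \<in> R) \<and>
     (\<forall>a \<in> R. \<forall>b \<in> R. a + b \<in> R \<and> a * b \<in> R)"

definition ideal_of :: "'a::ring set \<Rightarrow> 'a set \<Rightarrow> bool" where
  "ideal_of J R \<longleftrightarrow> nu_subring R \<and> J \<subseteq> R \<and> 0 \<in> J \<and> (\<forall>a \<in> J. - a \<in> J) \<and>
     (\<forall>a \<in> J. \<forall>b \<in> J. a + b \<in> J) \<and>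
     (\<forall>r \<in> R. \<forall>a \<in> J. r * a \<in> J \<and> a * r \<in> J)"

definition ring_iso_map :: "('a::ring \<rightharpoonup> 'a) \<Rightarrow> 'a set \<Rightarrow> 'a set \<Rightarrow> bool" where
  "ring_iso_map u R S \<longleftrightarrow> nu_subring R \<and> nu_subring S \<and>
     pbij u \<and> dom u = R \<and> ran u = S \<and>
     (\<forall>a \<in> R. \<forall>b \<in> R. the (u (a + b)) = the (u a) + the (u b) \<and>
                       the (u (a * b)) = the (u a) * the (u b))"


section \<open>Partial actions\<close>

definition partial_action ::
    "'g arrows \<Rightarrow> 'a::ring set \<Rightarrow> ('g \<Rightarrow> 'a set) \<Rightarrow> ('g \<Rightarrow> 'a \<rightharpoonup> 'a) \<Rightarrow> bool" where
  "partial_action G R A \<alpha> \<longleftrightarrow> nu_subring R \<and>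
     (\<forall>g \<in> arr G. ideal_of (A (tgt G g)) R \<and> ideal_of (A g) (A (tgt G g)) \<and>
                   ring_iso_map (\<alpha> g) (A (ginv G g)) (A g)) \<and>
     (\<forall>y \<in> objs G. \<alpha> y = pid (A y)) \<and>
     (\<forall>g \<in> arr G. \<forall>h \<in> arr G. src G g = tgt G h \<longrightarrow> \<alpha> g \<circ>\<^sub>m \<alpha> h \<subseteq>\<^sub>m \<alpha> (cmp G g h))"

definition group_partial_action ::
    "'g arrows \<Rightarrow> 'a::ring set \<Rightarrow> ('g \<Rightarrow> 'a set) \<Rightarrow> ('g \<Rightarrow> 'a \<rightharpoonup> 'a) \<Rightarrow> bool" where
  "group_partial_action H R A \<alpha> \<longleftrightarrow>
     groupoid H \<and> (\<exists>e. objs H = {e} \<and> A e = R) \<and> partial_action H R A \<alpha>"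


section \<open>The data from which the partial action is built\<close>

text \<open>
  The ambient ring is the whole type \<open>'a\<close>. All the ideals $I_y$, $I_{\tau_y}$, $I_{\tau_y^{-1}}$
  and $I_h$ are the values of one family \<open>I\<close> on morphisms: the index sets
  \<open>objs G\<close>, $\{\tau_y\}$, $\{\tau_y^{-1}\}$ and \<open>homset G x x\<close> overlap only in $x = \tau_x$, where the
  corresponding ideals are required to coincide anyway. Values of \<open>I\<close> elsewhere are irrelevant.
  The two families of maps are kept separate: \<open>\<gamma>\<tau> y\<close> is $\gamma_{\tau_y}$, and \<open>\<gamma>x h\<close> is
  $\gamma_h$.
\<close>

definition range_ideal :: "'g arrows \<Rightarrow> ('g \<Rightarrow> 'g) \<Rightarrow> ('g \<Rightarrow> 'a::ring set) \<Rightarrow>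
    ('g \<Rightarrow> 'a \<rightharpoonup> 'a) \<Rightarrow> ('g \<Rightarrow> 'a \<rightharpoonup> 'a) \<Rightarrow> 'g \<Rightarrow> 'a set" where
  "range_ideal G \<tau> I \<gamma>\<tau> \<gamma>x g =
     pimage (\<gamma>\<tau> (tgt G g))
       (I (ginv G (\<tau> (tgt G g))) \<inter>
        pimage (\<gamma>x (loop_of G \<tau> g))
          (I (ginv G (\<tau> (src G g))) \<inter> I (ginv G (loop_of G \<tau> g))))"

definition datum :: "'g arrows \<Rightarrow> 'g \<Rightarrow> ('g \<Rightarrow> 'g) \<Rightarrow> ('g \<Rightarrow> 'a::ring set) \<Rightarrow>
    ('g \<Rightarrow> 'a \<rightharpoonup> 'a) \<Rightarrow> ('g \<Rightarrow> 'a \<rightharpoonup> 'a) \<Rightarrow> bool" where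
  "datum G x \<tau> I \<gamma>\<tau> \<gamma>x \<longleftrightarrow>
     (\<forall>y \<in> objs G. ideal_of (I y) UNIV) \<and>
     (\<forall>y \<in> objs G. ring_iso_map (\<gamma>\<tau> y) (I (ginv G (\<tau> y))) (I (\<tau> y))) \<and>
     group_partial_action (vertex_group G x) (I x) I \<gamma>x \<and>
     \<gamma>x x = pid (I x) \<and> \<gamma>\<tau> x = pid (I x) \<and> I (\<tau> x) = I x \<and>
     (\<forall>y \<in> objs G. ideal_of (I (\<tau> y)) (I y) \<and> ideal_of (I (ginv G (\<tau> y))) (I x)) \<and>
     (\<forall>g \<in> arr G. ideal_of (range_ideal G \<tau> I \<gamma>\<tau> \<gamma>x g) (I (tgt G g)))"

definition beta :: "'g arrows \<Rightarrow> ('g \<Rightarrow> 'g) \<Rightarrow> ('g \<Rightarrow> 'a::ring set) \<Rightarrow>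
    ('g \<Rightarrow> 'a \<rightharpoonup> 'a) \<Rightarrow> ('g \<Rightarrow> 'a \<rightharpoonup> 'a) \<Rightarrow> 'g \<Rightarrow> 'a \<rightharpoonup> 'a" where
  "beta G \<tau> I \<gamma>\<tau> \<gamma>x g =
     (if g \<in> objs G then pid (I g)
      else \<gamma>\<tau> (tgt G g) \<circ>\<^sub>m (\<gamma>x (loop_of G \<tau> g) \<circ>\<^sub>m pinv (\<gamma>\<tau> (src G g))))"

end

theory Submission
  imports Defs
begin

text \<open>
  Let \<open>\<delta>\<^sub>g\<close> be the composite $\gamma_{\tau_{t(g)}} \gamma_{g_x} \gamma_{\tau_{s(g)}}^{-1}$ for every
  \<open>g\<close>, objects included. Since $(gh)_x = g_x h_x$, the inner factors $\gamma_\tau^{-1}$ and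
  $\gamma_\tau$ cancel in \<open>\<delta>\<^sub>g \<circ> \<delta>\<^sub>h\<close>, which is therefore contained in \<open>\<delta>\<^bsub>gh\<^esub>\<close>; likewise
  \<open>\<delta>\<close> at the inverse arrow is the inverse partial bijection. The maps \<open>\<beta>\<close> differ from \<open>\<delta>\<close> only at
  objects \<open>y\<close>, where the identity of $I_{\tau_y}$ is enlarged to the identity of $I_y$, so both
  properties pass to \<open>\<beta>\<close>.
\<close>

section \<open>Groupoids and loops\<close>

lemma groupoidD:
  assumes "groupoid G"
  shows groupoid_src_objs: "g \<in> arr G \<Longrightarrow> src G g \<in> objs G"
    and groupoid_tgt_objs: "g \<in> arr G \<Longrightarrow> tgt G g \<in> objs G"
    and groupoid_cmp_src: "g \<in> arr G \<Longrightarrow> cmp G g (src G g) = g"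
    and groupoid_cmp_tgt: "g \<in> arr G \<Longrightarrow> cmp G (tgt G g) g = g"
    and groupoid_cmp_arr: "g \<in> arr G \<Longrightarrow> h \<in> arr G \<Longrightarrow> src G g = tgt G h \<Longrightarrow> cmp G g h \<in> arr G"
    and groupoid_src_cmp: "g \<in> arr G \<Longrightarrow> h \<in> arr G \<Longrightarrow> src G g = tgt G h \<Longrightarrow>
          src G (cmp G g h) = src G h"
    and groupoid_tgt_cmp: "g \<in> arr G \<Longrightarrow> h \<in> arr G \<Longrightarrow> src G g = tgt G h \<Longrightarrow>
          tgt G (cmp G g h) = tgt G g"
    and groupoid_assoc: "g \<in> arr G \<Longrightarrow> h \<in> arr G \<Longrightarrow> k \<in> arr G \<Longrightarrow> src G g = tgt G h \<Longrightarrow>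
          src G h = tgt G k \<Longrightarrow> cmp G (cmp G g h) k = cmp G g (cmp G h k)"
  using assms unfolding groupoid_def small_category_def by blast+

lemma objsD:
  assumes "y \<in> objs G"
  shows objs_arr: "y \<in> arr G" and src_obj: "src G y = y" and tgt_obj: "tgt G y = y"
  using assms by (auto simp: objs_def)

lemma inverse_arrow_unique:
  assumes G: "groupoid G" and g: "g \<in> arr G" and "inverse_arrow G g h" "inverse_arrow G g k"
  shows "h = k"
proof -
  have "h = cmp G h (cmp G g k)"
    using assms groupoid_cmp_src[OF G] unfolding inverse_arrow_def by metis
  also have "\<dots> = cmp G (cmp G h g) k"
    using assms groupoid_assoc[OF G] unfolding inverse_arrow_def by metis
  also have "\<dots> = k"
    using assms groupoid_cmp_tgt[OF G] unfolding inverse_arrow_def by metis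
  finally show ?thesis .
qed

lemma ginv_eqI:
  assumes "groupoid G" "g \<in> arr G" "inverse_arrow G g h"
  shows "ginv G g = h"
  unfolding ginv_def using assms(3) by (rule the_equality) (rule inverse_arrow_unique[OF assms(1,2) _ assms(3)])

lemma inverse_arrow_ginv:
  assumes "groupoid G" "g \<in> arr G"
  shows "inverse_arrow G g (ginv G g)"
  using assms ginv_eqI[OF assms] unfolding groupoid_def by blast

lemma ginvD:
  assumes "groupoid G" "g \<in> arr G"
  shows ginv_arr: "ginv G g \<in> arr G"
    and src_ginv: "src G (ginv G g) = tgt G g"
    and tgt_ginv: "tgt G (ginv G g) = src G g"
    and cmp_ginv_left: "cmp G (ginv G g) g = src G g"
    and cmp_ginv_right: "cmp G g (ginv G g) = tgt G g"
  using inverse_arrow_ginv[OF assms] unfolding inverse_arrow_def by blast+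

lemma ginv_ginv:
  assumes "groupoid G" "g \<in> arr G"
  shows "ginv G (ginv G g) = g"
  using assms by (intro ginv_eqI) (auto simp: inverse_arrow_def ginvD)

lemma ginv_obj:
  assumes "groupoid G" "y \<in> objs G"
  shows "ginv G y = y"
  using assms groupoid_cmp_src[OF assms(1), of y]
  by (intro ginv_eqI) (auto simp: inverse_arrow_def objsD)

lemma ginv_notin_objs:
  assumes "groupoid G" "g \<in> arr G" "g \<notin> objs G"
  shows "ginv G g \<notin> objs G"
  using assms ginv_ginv ginv_obj by metis

section \<open>Transversals and loops at the base point\<close>

lemma transversalD:
  assumes "transversal G x \<tau>" "y \<in> objs G"
  shows transversal_arr: "\<tau> y \<in> arr G"
    and src_transversal: "src G (\<tau> y) = x"
    and tgt_transversal: "tgt G (\<tau> y) = y"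
  using assms by (auto simp: transversal_def homset_def)

lemma loop_of_homset:
  assumes "groupoid G" "transversal G x \<tau>" "g \<in> arr G"
  shows "loop_of G \<tau> g \<in> homset G x x"
  using assms by (simp add: loop_of_def homset_def groupoidD ginvD transversalD)

lemma loop_of_obj:
  assumes "groupoid G" "transversal G x \<tau>" "y \<in> objs G"
  shows "loop_of G \<tau> y = x"
proof -
  have "cmp G y (\<tau> y) = \<tau> y"
    using groupoid_cmp_tgt[OF assms(1), of "\<tau> y"] assms by (simp add: transversalD)
  then show ?thesis
    using assms by (simp add: loop_of_def objsD ginvD transversalD)
qed

text \<open>The loop of \<open>g\<close> starts with the transversal arrow at
  \<open>src G g\<close>, and the loop of \<open>h\<close> ends with the inverse of the one at
  \<open>tgt G h\<close>. These objects agree, so the two arrows cancel.\<close>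

lemma loop_of_cmp:
  assumes G: "groupoid G" and \<tau>: "transversal G x \<tau>"
    and g: "g \<in> arr G" and h: "h \<in> arr G" and gh: "src G g = tgt G h"
  shows "loop_of G \<tau> (cmp G g h) = cmp G (loop_of G \<tau> g) (loop_of G \<tau> h)"
proof -
  \<comment> \<open>The two loops become \<open>a\<close> inverse times \<open>g b\<close> and
    \<open>b\<close> inverse times \<open>c\<close>, so reassociation only has to isolate
    \<open>b\<close> times its inverse.\<close>
  define a where "a = \<tau> (tgt G g)"
  define b where "b = \<tau> (tgt G h)"
  define c where "c = cmp G h (\<tau> (src G h))"
  have b: "b \<in> arr G" "src G b = x" "tgt G b = tgt G h"
    using assms by (simp_all add: b_def groupoidD transversalD)
  have a: "a \<in> arr G" "src G a = x" "tgt G a = tgt G g"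
    using assms by (simp_all add: a_def groupoidD transversalD)
  have c: "c \<in> arr G" "src G c = x" "tgt G c = tgt G h"
    using assms by (simp_all add: c_def groupoidD transversalD)
  note gr = groupoid_src_objs[OF G] groupoid_tgt_objs[OF G] groupoid_cmp_arr[OF G]
    groupoid_src_cmp[OF G] groupoid_tgt_cmp[OF G] ginvD[OF G]
  have "cmp G (cmp G (ginv G a) (cmp G g b)) (cmp G (ginv G b) c)
      = cmp G (ginv G a) (cmp G (cmp G g b) (cmp G (ginv G b) c))"
    by (rule groupoid_assoc[OF G]) (simp_all add: gr a b c g h gh)
  also have "cmp G (cmp G g b) (cmp G (ginv G b) c) = cmp G g (cmp G b (cmp G (ginv G b) c))"
    by (rule groupoid_assoc[OF G]) (simp_all add: gr a b c g h gh)
  also have "cmp G b (cmp G (ginv G b) c) = cmp G (cmp G b (ginv G b)) c"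
    by (rule groupoid_assoc[OF G, symmetric]) (simp_all add: gr b c)
  also have "cmp G (cmp G b (ginv G b)) c = c"
    using groupoid_cmp_tgt[OF G c(1)] by (simp add: gr b c)
  also have "cmp G g c = cmp G (cmp G g h) (\<tau> (src G h))"
    unfolding c_def using assms
    by (intro groupoid_assoc[OF G, symmetric]) (simp_all add: gr transversalD)
  finally show ?thesis
    using assms by (simp add: loop_of_def gr gh a_def b_def c_def)
qed

text \<open>A two-sided inverse exists, hence any left inverse equals it. For
  \<open>loop_of_ginv\<close>, a single product then has to be computed.\<close>

lemma groupoid_left_inverse_eq:
  assumes G: "groupoid G" and "g \<in> arr G" "h \<in> arr G" "src G h = tgt G g" "cmp G h g = src G g"
  shows "ginv G g = h"
proof -
  have "h = cmp G h (cmp G g (ginv G g))"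
    using assms groupoid_cmp_src[OF G, of h] by (simp add: ginvD)
  also have "\<dots> = cmp G (cmp G h g) (ginv G g)"
    by (rule groupoid_assoc[OF G, symmetric]) (use assms in \<open>simp_all add: ginvD\<close>)
  also have "\<dots> = ginv G g"
    using assms groupoid_cmp_tgt[OF G, of "ginv G g"] by (simp add: ginvD)
  finally show ?thesis ..
qed

text \<open>Multiplicativity of loops applies to \<open>cmp G (ginv G g) g\<close>, which is the
  object \<open>src G g\<close> and so has loop \<open>x\<close>.\<close>

lemma loop_of_ginv:
  assumes G: "groupoid G" and \<tau>: "transversal G x \<tau>" and g: "g \<in> arr G"
  shows "loop_of G \<tau> (ginv G g) = ginv G (loop_of G \<tau> g)"
proof -
  have "cmp G (loop_of G \<tau> (ginv G g)) (loop_of G \<tau> g) = x"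
    using loop_of_cmp[OF G \<tau> ginv_arr[OF G g] g] loop_of_obj[OF G \<tau>] assms
    by (simp add: groupoidD ginvD)
  then show ?thesis
    using loop_of_homset[OF G \<tau> g] loop_of_homset[OF G \<tau> ginv_arr[OF G g]]
    by (intro groupoid_left_inverse_eq[OF G, symmetric]) (auto simp: homset_def)
qed

text \<open>\<open>ginv\<close> is a description over the arrow set, which shrinks in the vertex
  group. The inverse in \<open>G\<close> of a loop at \<open>x\<close> is again such a loop, so
  uniqueness identifies the two. This matches the domains in the group action with the ideals
  \<open>I (ginv G h)\<close> of \<open>range_ideal\<close>.\<close>

lemma ginv_vertex_group:
  assumes "groupoid G" "groupoid (vertex_group G x)" "h \<in> homset G x x"
  shows "ginv (vertex_group G x) h = ginv G h"
  using assms by (intro ginv_eqI) (auto simp: inverse_arrow_def vertex_group_def homset_def ginvD)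


section \<open>Partial bijections and isomorphisms between subrings\<close>

lemma pid_eq_Some_iff [simp]: "pid X a = Some b \<longleftrightarrow> a \<in> X \<and> b = a"
  by (auto simp: pid_def restrict_map_def)

lemma ran_pid [simp]: "ran (pid X) = X"
  by (auto simp: ran_def)

lemma dom_pid [simp]: "dom (pid X) = X"
  by (auto simp: dom_def)

lemma pbijI:
  assumes "\<And>a a' b. u a = Some b \<Longrightarrow> u a' = Some b \<Longrightarrow> a = a'"
  shows "pbij u"
  unfolding pbij_def inj_on_def using assms by (metis domD)

lemma pbijD:
  assumes "pbij u" "u a = Some b" "u a' = Some b"
  shows "a = a'"
  using assms unfolding pbij_def inj_on_def by (metis domI)

text \<open>Injectivity makes the description in \<open>pinv\<close> well defined, so
  \<open>pinv u\<close> is the graph of \<open>u\<close> read backwards.\<close>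

lemma pinv_eq_Some_iff:
  assumes "pbij u"
  shows "pinv u b = Some a \<longleftrightarrow> u a = Some b"
proof
  assume "pinv u b = Some a"
  then obtain a' where "u a' = Some b" and "a = (THE a. u a = Some b)"
    unfolding pinv_def ran_def by (auto split: if_splits)
  then show "u a = Some b"
    using pbijD[OF assms] by (metis (mono_tags, lifting) theI)
next
  assume "u a = Some b"
  moreover from this have "(THE a. u a = Some b) = a"
    using pbijD[OF assms] by blast
  ultimately show "pinv u b = Some a"
    unfolding pinv_def ran_def by auto
qed

lemma mem_pimage_iff: "b \<in> pimage u X \<longleftrightarrow> (\<exists>a \<in> X. u a = Some b)"
  by (auto simp: pimage_def ran_def restrict_map_def split: if_splits)

section \<open>Ideals and ring isomorphisms as partial maps\<close>

lemma ideal_of_nu_subring: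
  assumes "ideal_of J R"
  shows "nu_subring J"
  using assms unfolding ideal_of_def nu_subring_def by blast

lemma ideal_of_refl:
  assumes "nu_subring R"
  shows "ideal_of R R"
  using assms unfolding ideal_of_def nu_subring_def by blast

text \<open>Additivity and multiplicativity without the junk values \<open>the None\<close>.\<close>

lemma ring_iso_mapI:
  assumes "nu_subring R" "nu_subring S" "pbij u" "dom u = R" "ran u = S"
    and "\<And>a b c d. u a = Some c \<Longrightarrow> u b = Some d \<Longrightarrow>
           u (a + b) = Some (c + d) \<and> u (a * b) = Some (c * d)"
  shows "ring_iso_map u R S"
  unfolding ring_iso_map_def
proof (intro conjI ballI assms(1-5))
  fix a b assume "a \<in> R" "b \<in> R"
  then obtain c d where "u a = Some c" "u b = Some d"
    using assms(4) by blast
  with assms(6) show "the (u (a + b)) = the (u a) + the (u b)"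
    and "the (u (a * b)) = the (u a) * the (u b)"
    by (metis option.sel)+
qed

lemma ring_iso_map_hom:
  assumes "ring_iso_map u R S" "u a = Some c" "u b = Some d"
  shows "u (a + b) = Some (c + d)" "u (a * b) = Some (c * d)"
proof -
  have R: "a \<in> R" "b \<in> R"
    using assms unfolding ring_iso_map_def by blast+
  \<comment> \<open>The domain is a subring, so \<open>u\<close> is defined at the sum and at the
    product.\<close>
  then have "a + b \<in> dom u" "a * b \<in> dom u"
    using assms(1) unfolding ring_iso_map_def nu_subring_def by blast+
  moreover have "the (u (a + b)) = c + d" "the (u (a * b)) = c * d"
    using assms R unfolding ring_iso_map_def by simp_all
  ultimately show "u (a + b) = Some (c + d)" "u (a * b) = Some (c * d)"
    by (metis domD option.sel)+
qed

lemma ring_iso_map_pbij: "ring_iso_map u R S \<Longrightarrow> pbij u"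
  and ring_iso_map_dom: "ring_iso_map u R S \<Longrightarrow> dom u = R"
  and ring_iso_map_ran: "ring_iso_map u R S \<Longrightarrow> ran u = S"
  by (auto simp: ring_iso_map_def)

lemma ring_iso_map_pid:
  assumes "nu_subring R"
  shows "ring_iso_map (pid R) R R"
  using assms by (intro ring_iso_mapI pbijI) (auto simp: nu_subring_def)

text \<open>The composition axiom for the inverse of \<open>h\<close> and \<open>h\<close> bounds
  the composite by the identity of \<open>A (src H h)\<close>. Nothing is lost on the way, since the
  range \<open>A h\<close> of \<open>\<alpha> h\<close> is the whole domain of the map at the
  inverse.\<close>

lemma partial_action_ginv_iff:
  assumes H: "groupoid H" and act: "partial_action H R A \<alpha>" and h: "h \<in> arr H"
  shows "\<alpha> (ginv H h) b = Some a \<longleftrightarrow> \<alpha> h a = Some b"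
proof -
  \<comment> \<open>One implication for every arrow is enough: the converse is its instance at
    \<open>ginv H h\<close>.\<close>
  have *: "\<alpha> (ginv H k) b = Some a" if k: "k \<in> arr H" and ab: "\<alpha> k a = Some b" for k a b
  proof -
    have k': "ginv H k \<in> arr H" "src H (ginv H k) = tgt H k"
      using H k by (simp_all add: ginvD)
    have iso: "ring_iso_map (\<alpha> g) (A (ginv H g)) (A g)" if "g \<in> arr H" for g
      using act that unfolding partial_action_def by blast
    have "ran (\<alpha> k) = A k" "dom (\<alpha> (ginv H k)) = A (ginv H (ginv H k))"
      using ring_iso_map_ran[OF iso[OF k]] ring_iso_map_dom[OF iso[OF k'(1)]] by simp_all
    then have "b \<in> dom (\<alpha> (ginv H k))"
      using ab ginv_ginv[OF H k] by (auto simp: ran_def)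
    then obtain c where c: "\<alpha> (ginv H k) b = Some c"
      by blast
    then have "(\<alpha> (ginv H k) \<circ>\<^sub>m \<alpha> k) a = Some c"
      using ab by simp
    moreover have "\<alpha> (ginv H k) \<circ>\<^sub>m \<alpha> k \<subseteq>\<^sub>m \<alpha> (cmp H (ginv H k) k)"
      using act k k' unfolding partial_action_def by blast
    ultimately have "\<alpha> (src H k) a = Some c"
      using cmp_ginv_left[OF H k] by (metis domI map_le_def)
    moreover have "\<alpha> (src H k) = pid (A (src H k))"
      using act groupoid_src_objs[OF H k] unfolding partial_action_def by blast
    ultimately show ?thesis
      using c by simp
  qed
  show ?thesis
    using *[OF h] *[OF ginv_arr[OF H h]] ginv_ginv[OF H h] by metis
qed


section \<open>Conjugation along the transversal\<close>

definition conj_map :: "'g arrows \<Rightarrow> ('g \<Rightarrow> 'g) \<Rightarrow> ('g \<Rightarrow> 'a \<rightharpoonup> 'a) \<Rightarrow> ('g \<Rightarrow> 'a \<rightharpoonup> 'a) \<Rightarrow>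
    'g \<Rightarrow> 'a \<rightharpoonup> 'a" where
  "conj_map G \<tau> \<gamma>\<tau> \<gamma>x g =
     \<gamma>\<tau> (tgt G g) \<circ>\<^sub>m (\<gamma>x (loop_of G \<tau> g) \<circ>\<^sub>m pinv (\<gamma>\<tau> (src G g)))"

locale datum_context =
  fixes G :: "'g arrows" and x :: 'g and \<tau> :: "'g \<Rightarrow> 'g"
    and I :: "'g \<Rightarrow> 'a::ring set"
    and \<gamma>\<tau> \<gamma>x :: "'g \<Rightarrow> 'a \<rightharpoonup> 'a"
  assumes connected: "connected_groupoid G"
    and base: "x \<in> objs G"
    and trans: "transversal G x \<tau>"
    and dat: "datum G x \<tau> I \<gamma>\<tau> \<gamma>x"
begin

abbreviation "\<delta> \<equiv> conj_map G \<tau> \<gamma>\<tau> \<gamma>x"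
abbreviation "\<beta> \<equiv> beta G \<tau> I \<gamma>\<tau> \<gamma>x"

lemma gpd: "groupoid G"
  using connected by (simp add: connected_groupoid_def)

section \<open>The conditions on the datum, with inverses and products taken in
  \<open>G\<close>\<close>

lemma ideal_I: "y \<in> objs G \<Longrightarrow> ideal_of (I y) UNIV"
  and iso_\<gamma>\<tau>: "y \<in> objs G \<Longrightarrow> ring_iso_map (\<gamma>\<tau> y) (I (ginv G (\<tau> y))) (I (\<tau> y))"
  and vertex_action: "group_partial_action (vertex_group G x) (I x) I \<gamma>x"
  and \<gamma>x_base: "\<gamma>x x = pid (I x)"
  and ideal_I_\<tau>: "y \<in> objs G \<Longrightarrow> ideal_of (I (\<tau> y)) (I y)"
  and ideal_range: "g \<in> arr G \<Longrightarrow> ideal_of (range_ideal G \<tau> I \<gamma>\<tau> \<gamma>x g) (I (tgt G g))"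
  using dat by (simp_all add: datum_def)

lemma vertex_gpd: "groupoid (vertex_group G x)"
  and vertex_partial_action: "partial_action (vertex_group G x) (I x) I \<gamma>x"
  using vertex_action by (auto simp: group_partial_action_def)

lemma iso_\<gamma>x:
  assumes "h \<in> homset G x x"
  shows "ring_iso_map (\<gamma>x h) (I (ginv G h)) (I h)"
  using vertex_partial_action assms ginv_vertex_group[OF gpd vertex_gpd assms]
  unfolding partial_action_def by (auto simp: vertex_group_def)

lemma \<gamma>x_ginv_iff:
  assumes "h \<in> homset G x x"
  shows "\<gamma>x (ginv G h) b = Some a \<longleftrightarrow> \<gamma>x h a = Some b"
  using partial_action_ginv_iff[OF vertex_gpd vertex_partial_action, of h] assms
    ginv_vertex_group[OF gpd vertex_gpd assms]
  by (simp add: vertex_group_def)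

lemma \<gamma>x_cmp:
  assumes "g \<in> homset G x x" "h \<in> homset G x x" "\<gamma>x h a = Some b" "\<gamma>x g b = Some c"
  shows "\<gamma>x (cmp G g h) a = Some c"
proof -
  have "\<gamma>x g \<circ>\<^sub>m \<gamma>x h \<subseteq>\<^sub>m \<gamma>x (cmp G g h)"
    using vertex_partial_action assms(1,2) unfolding partial_action_def
    by (auto simp: vertex_group_def homset_def)
  moreover have "(\<gamma>x g \<circ>\<^sub>m \<gamma>x h) a = Some c"
    using assms by simp
  ultimately show ?thesis
    by (metis domI map_le_def)
qed

section \<open>The conjugated maps \<delta>\<close>

text \<open>Here \<open>p\<close> is the preimage of \<open>a\<close> under the injective map at the
  source. Replacing \<open>pinv\<close> by this chain of graph relations makes the description
  symmetric in source and target.\<close>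

lemma \<delta>_eq_Some_iff:
  assumes "g \<in> arr G"
  shows "\<delta> g a = Some b \<longleftrightarrow>
    (\<exists>p q. \<gamma>\<tau> (src G g) p = Some a \<and> \<gamma>x (loop_of G \<tau> g) p = Some q \<and> \<gamma>\<tau> (tgt G g) q = Some b)"
  using pinv_eq_Some_iff[OF ring_iso_map_pbij[OF iso_\<gamma>\<tau>[OF groupoid_src_objs[OF gpd assms]]]]
  by (auto simp: conj_map_def map_comp_Some_iff)

text \<open>The chain of witnesses is read backwards: source and target swap, and the loop is
  replaced by its inverse, which reverses the middle link.\<close>

lemma \<delta>_ginv_iff:
  assumes "g \<in> arr G"
  shows "\<delta> (ginv G g) b = Some a \<longleftrightarrow> \<delta> g a = Some b"
  using \<delta>_eq_Some_iff[OF assms] \<delta>_eq_Some_iff[OF ginv_arr[OF gpd assms]]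
    \<gamma>x_ginv_iff[OF loop_of_homset[OF gpd trans assms]] loop_of_ginv[OF gpd trans assms]
  by (auto simp: ginvD[OF gpd assms])

text \<open>The map at the inverse arrow is single-valued and sends a common image back to each of
  its preimages.\<close>

lemma pbij_\<delta>:
  assumes "g \<in> arr G"
  shows "pbij (\<delta> g)"
  using \<delta>_ginv_iff[OF assms] by (intro pbijI) (metis option.inject)

lemma dom_\<delta>:
  assumes "g \<in> arr G"
  shows "dom (\<delta> g) = ran (\<delta> (ginv G g))"
  using \<delta>_ginv_iff[OF assms] by (auto simp: ran_def)

text \<open>The intersections in \<open>range_ideal\<close> are exactly the domain conditions under
  which the three maps compose.\<close>

lemma ran_\<delta>:
  assumes g: "g \<in> arr G"
  shows "ran (\<delta> g) = range_ideal G \<tau> I \<gamma>\<tau> \<gamma>x g"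
proof -
  have s: "p \<in> I (ginv G (\<tau> (src G g))) \<longleftrightarrow> (\<exists>a. \<gamma>\<tau> (src G g) p = Some a)" for p
    using ring_iso_map_dom[OF iso_\<gamma>\<tau>[OF groupoid_src_objs[OF gpd g]]] by blast
  have t: "q \<in> I (ginv G (\<tau> (tgt G g))) \<longleftrightarrow> (\<exists>a. \<gamma>\<tau> (tgt G g) q = Some a)" for q
    using ring_iso_map_dom[OF iso_\<gamma>\<tau>[OF groupoid_tgt_objs[OF gpd g]]] by blast
  have l: "p \<in> I (ginv G (loop_of G \<tau> g)) \<longleftrightarrow> (\<exists>a. \<gamma>x (loop_of G \<tau> g) p = Some a)" for p
    using ring_iso_map_dom[OF iso_\<gamma>x[OF loop_of_homset[OF gpd trans g]]] by blast
  have "b \<in> ran (\<delta> g) \<longleftrightarrow> b \<in> range_ideal G \<tau> I \<gamma>\<tau> \<gamma>x g" for b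
    unfolding range_ideal_def mem_pimage_iff ran_def mem_Collect_eq \<delta>_eq_Some_iff[OF g]
      Bex_def Int_iff s t l
    by blast
  then show ?thesis
    by blast
qed

text \<open>This rests on the last clause of \<open>datum\<close>. Applied to the inverse arrow it
  also shows that the domain of the map is a subring.\<close>

lemma nu_subring_ran_\<delta>:
  assumes "g \<in> arr G"
  shows "nu_subring (ran (\<delta> g))"
  using ideal_of_nu_subring[OF ideal_range[OF assms]] ran_\<delta>[OF assms] by simp

lemma ring_iso_map_\<delta>:
  assumes g: "g \<in> arr G"
  shows "ring_iso_map (\<delta> g) (ran (\<delta> (ginv G g))) (ran (\<delta> g))"
proof (rule ring_iso_mapI)
  fix a b c d assume "\<delta> g a = Some c" "\<delta> g b = Some d"
  then obtain p q p' q' where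
    "\<gamma>\<tau> (src G g) p = Some a" "\<gamma>x (loop_of G \<tau> g) p = Some q" "\<gamma>\<tau> (tgt G g) q = Some c"
    "\<gamma>\<tau> (src G g) p' = Some b" "\<gamma>x (loop_of G \<tau> g) p' = Some q'" "\<gamma>\<tau> (tgt G g) q' = Some d"
    unfolding \<delta>_eq_Some_iff[OF g] by blast
  \<comment> \<open>Adding or multiplying the two chains termwise gives the witnesses for the sum
    and the product.\<close>
  then have
    "\<gamma>\<tau> (src G g) (p + p') = Some (a + b) \<and> \<gamma>x (loop_of G \<tau> g) (p + p') = Some (q + q') \<and>
     \<gamma>\<tau> (tgt G g) (q + q') = Some (c + d)"
    "\<gamma>\<tau> (src G g) (p * p') = Some (a * b) \<and> \<gamma>x (loop_of G \<tau> g) (p * p') = Some (q * q') \<and>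
     \<gamma>\<tau> (tgt G g) (q * q') = Some (c * d)"
    by (auto intro: ring_iso_map_hom[OF iso_\<gamma>\<tau>[OF groupoid_src_objs[OF gpd g]]]
        ring_iso_map_hom[OF iso_\<gamma>\<tau>[OF groupoid_tgt_objs[OF gpd g]]]
        ring_iso_map_hom[OF iso_\<gamma>x[OF loop_of_homset[OF gpd trans g]]])
  then show "\<delta> g (a + b) = Some (c + d) \<and> \<delta> g (a * b) = Some (c * d)"
    unfolding \<delta>_eq_Some_iff[OF g] by blast
qed (use g in \<open>simp_all add: nu_subring_ran_\<delta> ginv_arr[OF gpd] pbij_\<delta> dom_\<delta>\<close>)

lemma \<delta>_cmp:
  assumes g: "g \<in> arr G" and h: "h \<in> arr G" and gh: "src G g = tgt G h"
    and "\<delta> h a = Some b" "\<delta> g b = Some c"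
  shows "\<delta> (cmp G g h) a = Some c"
proof -
  obtain p q where 1: "\<gamma>\<tau> (src G h) p = Some a" "\<gamma>x (loop_of G \<tau> h) p = Some q"
      "\<gamma>\<tau> (tgt G h) q = Some b"
    using \<open>\<delta> h a = Some b\<close> unfolding \<delta>_eq_Some_iff[OF h] by blast
  obtain q' r where 2: "\<gamma>\<tau> (tgt G h) q' = Some b" "\<gamma>x (loop_of G \<tau> g) q' = Some r"
      "\<gamma>\<tau> (tgt G g) r = Some c"
    using \<open>\<delta> g b = Some c\<close> unfolding \<delta>_eq_Some_iff[OF g] gh by blast
  \<comment> \<open>The chain for \<open>h\<close> ends with the same injective map, at the same
    value \<open>b\<close>, from which the chain for \<open>g\<close> sets out.\<close>
  have "q' = q"
    using pbijD[OF ring_iso_map_pbij[OF iso_\<gamma>\<tau>[OF groupoid_tgt_objs[OF gpd h]]]] 1 2 by blast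
  then have "\<gamma>x (loop_of G \<tau> (cmp G g h)) p = Some r"
    unfolding loop_of_cmp[OF gpd trans g h gh]
    using 1 2 loop_of_homset[OF gpd trans] g h by (auto intro: \<gamma>x_cmp)
  then show ?thesis
    using \<delta>_eq_Some_iff[OF groupoid_cmp_arr[OF gpd g h gh]] 1 2 assms
    by (auto simp: groupoid_src_cmp[OF gpd] groupoid_tgt_cmp[OF gpd])
qed

section \<open>Passage from \<delta> to \<beta>\<close>

lemma \<beta>_obj: "y \<in> objs G \<Longrightarrow> \<beta> y = pid (I y)"
  and \<beta>_nonobj: "g \<notin> objs G \<Longrightarrow> \<beta> g = \<delta> g"
  by (simp_all add: beta_def conj_map_def)

text \<open>At an object the loop is \<open>x\<close>, which acts as an identity, so
  \<open>a = b\<close> lies in the range \<open>I (\<tau> g)\<close>, inside \<open>I g\<close>. The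
  inclusion is needed because a product of two non-objects can be an object.\<close>

lemma \<delta>_le_\<beta>:
  assumes g: "g \<in> arr G" and ab: "\<delta> g a = Some b"
  shows "\<beta> g a = Some b"
proof (cases "g \<in> objs G")
  case True
  then have "loop_of G \<tau> g = x" "src G g = g" "tgt G g = g"
    by (simp_all add: loop_of_obj[OF gpd trans] objsD)
  then obtain p where "\<gamma>\<tau> g p = Some a" "\<gamma>\<tau> g p = Some b"
    using ab unfolding \<delta>_eq_Some_iff[OF g] by (auto simp: \<gamma>x_base)
  moreover from this have "a \<in> I g"
    using ring_iso_map_ran[OF iso_\<gamma>\<tau>[OF True]] ideal_I_\<tau>[OF True]
    by (auto simp: ideal_of_def ran_def)
  ultimately show ?thesis
    using True by (simp add: \<beta>_obj)
qed (simp add: \<beta>_nonobj ab)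

lemma nu_subring_I: "y \<in> objs G \<Longrightarrow> nu_subring (I y)"
  using ideal_I ideal_of_nu_subring by blast

text \<open>Inversion preserves objects and non-objects, so \<open>g\<close> and its inverse fall
  under the same case of \<open>beta\<close>.\<close>

lemma ring_iso_map_\<beta>:
  assumes "g \<in> arr G"
  shows "ring_iso_map (\<beta> g) (ran (\<beta> (ginv G g))) (ran (\<beta> g))"
proof (cases "g \<in> objs G")
  case True
  then show ?thesis
    by (simp add: \<beta>_obj ginv_obj[OF gpd] ring_iso_map_pid nu_subring_I)
next
  case False
  then show ?thesis
    using assms by (simp add: \<beta>_nonobj ginv_notin_objs[OF gpd] ring_iso_map_\<delta>)
qed

lemma ideal_ran_\<beta>:
  assumes "g \<in> arr G"
  shows "ideal_of (ran (\<beta> g)) (I (tgt G g))"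
proof (cases "g \<in> objs G")
  case True
  then show ?thesis
    by (simp add: \<beta>_obj objsD ideal_of_refl nu_subring_I)
next
  case False
  then show ?thesis
    using assms by (simp add: \<beta>_nonobj ran_\<delta> ideal_range)
qed

lemma \<beta>_cmp:
  assumes g: "g \<in> arr G" and h: "h \<in> arr G" and gh: "src G g = tgt G h"
  shows "\<beta> g \<circ>\<^sub>m \<beta> h \<subseteq>\<^sub>m \<beta> (cmp G g h)"
proof -
  have "\<beta> (cmp G g h) a = Some c" if b: "\<beta> h a = Some b" and c: "\<beta> g b = Some c" for a b c
  \<comment> \<open>At an object \<beta> can be strictly larger than \<delta>, so
    \<open>\<delta>_cmp\<close> does not cover an object factor. Such a factor only restricts the
    map of the other one.\<close>
  proof (cases "g \<in> objs G \<or> h \<in> objs G")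
    case True
    then show ?thesis
    proof
      assume o: "g \<in> objs G"
      then have "cmp G g h = h"
        using groupoid_cmp_tgt[OF gpd h] gh by (simp add: objsD)
      then show ?thesis
        using o b c by (simp add: \<beta>_obj)
    next
      assume o: "h \<in> objs G"
      then have "cmp G g h = g"
        using groupoid_cmp_src[OF gpd g] gh by (simp add: objsD)
      then show ?thesis
        using o b c by (simp add: \<beta>_obj)
    qed
  next
    case False
    \<comment> \<open>Both factors are now values of \<delta>; their product may still be an object,
      which \<open>\<delta>_le_\<beta>\<close> absorbs.\<close>
    then show ?thesis
      using b c \<delta>_cmp[OF g h gh] groupoid_cmp_arr[OF gpd g h gh]
      by (auto simp: \<beta>_nonobj intro: \<delta>_le_\<beta>)
  qed
  then have "\<beta> (cmp G g h) a = Some c" if "(\<beta> g \<circ>\<^sub>m \<beta> h) a = Some c" for a c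
    using that unfolding map_comp_Some_iff by blast
  then show ?thesis
    unfolding map_le_def dom_def by fastforce
qed

lemma partial_action_\<beta>: "partial_action G UNIV (\<lambda>g. ran (\<beta> g)) \<beta>"
  unfolding partial_action_def
proof (intro conjI ballI impI)
  show "nu_subring (UNIV :: 'a set)"
    by (simp add: nu_subring_def)
qed (simp_all add: \<beta>_obj groupoid_tgt_objs[OF gpd] ideal_I ideal_ran_\<beta> ring_iso_map_\<beta> \<beta>_cmp)

lemma ran_\<beta>_obj: "y \<in> objs G \<Longrightarrow> ran (\<beta> y) = I y"
  and ran_\<beta>_nonobj: "g \<in> arr G - objs G \<Longrightarrow> ran (\<beta> g) = range_ideal G \<tau> I \<gamma>\<tau> \<gamma>x g"
  and pbij_\<beta>: "g \<in> arr G \<Longrightarrow> pbij (\<beta> g)"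
  using ring_iso_map_pbij[OF ring_iso_map_\<beta>] by (simp_all add: \<beta>_obj \<beta>_nonobj ran_\<delta>)

end

theorem theorem3p3:
  fixes G :: "'g arrows" and x :: 'g and \<tau> :: "'g \<Rightarrow> 'g"
    and I :: "'g \<Rightarrow> 'a::ring set"
    and \<gamma>\<tau> \<gamma>x :: "'g \<Rightarrow> 'a \<rightharpoonup> 'a"
    and \<beta> :: "'g \<Rightarrow> 'a \<rightharpoonup> 'a" and B :: "'g \<Rightarrow> 'a set"
  assumes "connected_groupoid G"
    and "x \<in> objs G"
    and "transversal G x \<tau>"
    and "datum G x \<tau> I \<gamma>\<tau> \<gamma>x"
  defines "\<beta> \<equiv> beta G \<tau> I \<gamma>\<tau> \<gamma>x"
    and "B \<equiv> (\<lambda>g. ran (\<beta> g))"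
  shows "(\<forall>g \<in> arr G. pbij (\<beta> g)) \<and>
         (\<forall>y \<in> objs G. B y = I y) \<and>
         (\<forall>g \<in> arr G - objs G. B g = range_ideal G \<tau> I \<gamma>\<tau> \<gamma>x g) \<and>
         partial_action G UNIV B \<beta>"
proof -
  have ctxt: "datum_context G x \<tau> I \<gamma>\<tau> \<gamma>x"
    using assms(1-4) by (rule datum_context.intro)
  show ?thesis
    unfolding \<beta>_def B_def
    using datum_context.pbij_\<beta>[OF ctxt] datum_context.ran_\<beta>_obj[OF ctxt]
      datum_context.ran_\<beta>_nonobj[OF ctxt] datum_context.partial_action_\<beta>[OF ctxt]
    by blast
qed

end
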